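(* Let $\mathcal{D}\subset\mathbb{R}^2$ be a circle and let $\mathcal{P}\subset\mathbb{R}^2$ be a parabola with focus $F$. Then $(\mathcal{D},\mathcal{P})$ is a $3$-Poncelet pair if and only if $F\in\mathcal{D}$ (i.e. the circle passes through $F$).
   Context: Real conics are identified with their complexifications in $\mathbb{CP}^2$, and polygons are taken in $\mathbb{CP}^2$ (vertices and sides may be non-real). For $n\ge 3$ and two smooth conics $\mathcal{C}_1,\mathcal{C}_2$, an $n$-Poncelet polygon is an $n$-gon ($n$ distinct vertices, $n$ distinct side lines) whose vertices lie on $\mathcal{C}_1$ (inscribed in $\mathcal{C}_1$) and whose side lines are tangent to $\mathcal{C}_2$ (circumscribed about $\mathcal{C}_2$); a $k$-gon traversed $m>1$ times is not regarded as an $mk$-gon. The ordered pair $(\mathcal{C}_1,\mathcal{C}_2)$ is an $n$-Poncelet pair if there exists an $n$-Poncelet polygon inscribed in $\mathcal{C}_1$ and circumscribed about $\mathcal{C}_2$. *)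

theory Defs
  imports "HOL-Analysis.Analysis"
begin

(* Points and lines of CP^2 are the complex linear subspaces of complex^3 of
   dimension 1 and 2; incidence is inclusion. *)

definition cp2_points :: "(complex ^ 3) set set" where
  "cp2_points = {p. vec.subspace p \<and> vec.dim p = 1}"

definition join :: "(complex ^ 3) set \<Rightarrow> (complex ^ 3) set \<Rightarrow> (complex ^ 3) set" where
  "join p q = vec.span (p \<union> q)"

(* Bilinear over the complex numbers too: no conjugation, unlike the inner product. *)
definition bform :: "'a::field ^ 'n ^ 'n \<Rightarrow> 'a ^ 'n \<Rightarrow> 'a ^ 'n \<Rightarrow> 'a" where
  "bform A v w = (\<Sum>i\<in>UNIV. \<Sum>j\<in>UNIV. A $ i $ j * v $ i * w $ j)"

definition conic_locus :: "complex ^ 3 ^ 3 \<Rightarrow> (complex ^ 3) set set" where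
  "conic_locus A = {p \<in> cp2_points. \<forall>v\<in>p. bform A v v = 0}"

definition is_smooth_conic_matrix :: "complex ^ 3 ^ 3 \<Rightarrow> bool" where
  "is_smooth_conic_matrix A \<longleftrightarrow> transpose A = A \<and> det A \<noteq> 0"

definition smooth_conic :: "(complex ^ 3) set set \<Rightarrow> bool" where
  "smooth_conic C \<longleftrightarrow> (\<exists>A. is_smooth_conic_matrix A \<and> C = conic_locus A)"

(* The tangent line at a point v of the conic v^T A v = 0 is the kernel of the
   differential, i.e. of w \<mapsto> 2 v^T A w.  The matrix A of a smooth conic is
   unique up to a nonzero scalar, so the choice of A is immaterial. *)
definition tangent_line :: "(complex ^ 3) set \<Rightarrow> (complex ^ 3) set set \<Rightarrow> bool" where
  "tangent_line l C \<longleftrightarrow> (\<exists>A. is_smooth_conic_matrix A \<and> C = conic_locus A \<and>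
     (\<exists>p\<in>C. l = {w. \<forall>v\<in>p. bform A v w = 0}))"

(* The vertices are V 0, ..., V (n - 1), in cyclic order. *)
definition side :: "nat \<Rightarrow> (nat \<Rightarrow> (complex ^ 3) set) \<Rightarrow> nat \<Rightarrow> (complex ^ 3) set" where
  "side n V i = join (V i) (V (Suc i mod n))"

definition is_polygon :: "nat \<Rightarrow> (nat \<Rightarrow> (complex ^ 3) set) \<Rightarrow> bool" where
  "is_polygon n V \<longleftrightarrow> n \<ge> 3 \<and> (\<forall>i<n. V i \<in> cp2_points) \<and>
     inj_on V {..<n} \<and> inj_on (side n V) {..<n}"

definition poncelet_polygon ::
    "nat \<Rightarrow> (complex ^ 3) set set \<Rightarrow> (complex ^ 3) set set \<Rightarrow>
     (nat \<Rightarrow> (complex ^ 3) set) \<Rightarrow> bool" where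
  "poncelet_polygon n C1 C2 V \<longleftrightarrow> is_polygon n V \<and>
     (\<forall>i<n. V i \<in> C1) \<and> (\<forall>i<n. tangent_line (side n V i) C2)"

definition poncelet_pair ::
    "nat \<Rightarrow> (complex ^ 3) set set \<Rightarrow> (complex ^ 3) set set \<Rightarrow> bool" where
  "poncelet_pair n C1 C2 \<longleftrightarrow> smooth_conic C1 \<and> smooth_conic C2 \<and>
     (\<exists>V. poncelet_polygon n C1 C2 V)"

definition homogeneous :: "real ^ 2 \<Rightarrow> real ^ 3" where
  "homogeneous x = vector [x $ 1, x $ 2, 1]"

definition complex_matrix :: "real ^ 3 ^ 3 \<Rightarrow> complex ^ 3 ^ 3" where
  "complex_matrix A = (\<chi> i j. complex_of_real (A $ i $ j))"

(* A plane curve given as a set of real affine points is sent to the set of points of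
   CP^2 satisfying every real homogeneous quadratic equation that holds on the curve.
   For a conic with at least five real points, no four of them collinear (such as a
   circle or a parabola), the equation is unique up to a scalar, and the result is the
   locus of that same equation in CP^2. *)
definition complexification :: "(real ^ 2) set \<Rightarrow> (complex ^ 3) set set" where
  "complexification S = {p \<in> cp2_points. \<forall>A :: real ^ 3 ^ 3.
     transpose A = A \<and> (\<forall>x\<in>S. bform A (homogeneous x) (homogeneous x) = 0)
       \<longrightarrow> p \<in> conic_locus (complex_matrix A)}"

definition is_circle :: "(real ^ 2) set \<Rightarrow> bool" where
  "is_circle D \<longleftrightarrow> (\<exists>c r. r > 0 \<and> D = sphere c r)"

definition is_parabola_with_focus :: "(real ^ 2) set \<Rightarrow> real ^ 2 \<Rightarrow> bool" where
  "is_parabola_with_focus P F \<longleftrightarrow> (\<exists>l. affine l \<and> aff_dim l = 1 \<and> F \<notin> l \<and>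
     P = {x. dist x F = infdist x l})"

end

theory Submission
  imports Defs
begin

text \<open>
  Let \<open>M\<close> be the matrix whose columns are the vertices of a triangle inscribed in the conic \<open>A\<close>
  and circumscribed about the conic \<open>B\<close>. In the basis \<open>M\<close> both the quadratic form of \<open>A\<close> and the
  dual form of \<open>B\<close>, with matrix the inverse of \<open>B\<close>, have zero diagonal. For such a pair the product
  \<open>X\<close> of the two matrices satisfies \<open>(tr X)\<^sup>2 = 2 tr (X\<^sup>2)\<close>, and this condition does not depend on the
  basis. For a circle and a parabola, in orthonormal coordinates centred at the focus, it says
  that the power of the focus with respect to the circle vanishes.

  Conversely, the line at infinity and the two isotropic lines through the focus are tangent to
  the parabola. They form a triangle whose vertices are the focus and the two circular points,
  and the circular points lie on every circle.
\<close>

section \<open>Invariants of a triangle between two conics\<close>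

lemma symmetric_matrix_nth:
  assumes "transpose A = A"
  shows "A $ i $ j = A $ j $ i"
proof -
  have "A $ i $ j = transpose A $ j $ i" by (simp add: transpose_def)
  with assms show ?thesis by simp
qed

text \<open>With p, q, r the products of corresponding off-diagonal entries of \<open>A\<close> and
  \<open>B\<close>, the trace of \<open>A ** B\<close> is 2(p + q + r) and the trace of its square
  is 2(p + q + r)^2.\<close>

lemma trace_square_zero_diagonal:
  fixes A B :: "'a::comm_ring_1 ^ 3 ^ 3"
  assumes "transpose A = A" "transpose B = B"
    and "\<And>k. A $ k $ k = 0" "\<And>k. B $ k $ k = 0"
  shows "(trace (A ** B))\<^sup>2 = 2 * trace ((A ** B) ** (A ** B))"
proof -
  have s: "A $ i $ j = A $ j $ i" "B $ i $ j = B $ j $ i" for i j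
    by (rule symmetric_matrix_nth; fact)+
  show ?thesis
    unfolding trace_def matrix_matrix_mult_def
    by (simp add: sum_3 assms(3,4) s[of 2 1] s[of 3 1] s[of 3 2] power2_eq_square algebra_simps)
qed

section \<open>Bilinear forms under a change of basis\<close>

lemma bform_eq_sum: "bform A v w = (\<Sum>i\<in>UNIV. v $ i * (A *v w) $ i)"
  by (simp add: bform_def matrix_vector_mult_def sum_distrib_left mult_ac)

lemma bform_scale: "bform A (c *s v) (d *s w) = c * d * bform A v w"
  by (simp add: bform_def sum_distrib_left mult_ac)

lemma bform_congruence:
  "bform (transpose S ** A ** S) v w = bform A (S *v v) (S *v w)"
proof -
  have "bform (transpose S ** A ** S) v w = (\<Sum>i\<in>UNIV. v $ i * (transpose S *v (A *v (S *v w))) $ i)"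
    by (simp add: bform_eq_sum matrix_vector_mul_assoc matrix_mul_assoc)
  also have "\<dots> = (\<Sum>i\<in>UNIV. \<Sum>j\<in>UNIV. S $ j $ i * v $ i * (A *v (S *v w)) $ j)"
    by (subst matrix_vector_mult_def) (simp add: transpose_def sum_distrib_left mult_ac)
  also have "\<dots> = (\<Sum>j\<in>UNIV. \<Sum>i\<in>UNIV. S $ j $ i * v $ i * (A *v (S *v w)) $ j)"
    by (rule sum.swap)
  also have "\<dots> = (\<Sum>j\<in>UNIV. (S *v v) $ j * (A *v (S *v w)) $ j)"
    by (subst (2) matrix_vector_mult_def) (simp add: sum_distrib_right)
  finally show ?thesis by (simp add: bform_eq_sum)
qed

lemma bform_axis: "bform A (axis k c) (axis l d) = c * d * A $ k $ l"
proof -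
  have "bform A (axis k c) (axis l d)
    = (\<Sum>i\<in>UNIV. \<Sum>j\<in>UNIV. if j = l then (if i = k then A $ i $ j * c * d else 0) else 0)"
    unfolding bform_def by (intro sum.cong refl) (simp add: axis_def)
  then show ?thesis by (simp add: mult_ac)
qed

text \<open>Column k of \<open>M\<close> is the k-th vertex, and the \<open>p\<close> belonging to k
  is the point where the opposite side touches the conic \<open>B\<close>. In the basis
  \<open>M\<close> the vertices are the coordinate points and the sides the coordinate lines, so
  incidence and tangency become vanishing diagonal entries of the form and of the dual form.\<close>

lemma triangle_trace_identity:
  fixes A B C M :: "'a::field ^ 3 ^ 3"
  assumes symA: "transpose A = A" and symB: "transpose B = B"
    and BC: "B ** C = mat 1" and M: "invertible M"
    and vertex: "\<And>k. bform A (column k M) (column k M) = 0"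
    and side: "\<And>k. \<exists>p. p \<noteq> 0 \<and> bform B p p = 0 \<and> (\<forall>j. j \<noteq> k \<longrightarrow> bform B p (column j M) = 0)"
  shows "(trace (A ** C))\<^sup>2 = 2 * trace ((A ** C) ** (A ** C))"
proof -
  obtain N where MN: "M ** N = mat 1" and NM: "N ** M = mat 1"
    using M unfolding invertible_def by auto
  have sB: "B $ i $ j = B $ j $ i" for i j
    by (rule symmetric_matrix_nth; fact)
  have CB: "C ** B = mat 1"
    using BC by (simp add: matrix_left_right_inverse)
  have symC: "transpose C = C"
  proof -
    have "transpose C ** B = mat 1"
      using arg_cong[OF BC, of transpose] by (simp add: matrix_transpose_mul symB)
    then show ?thesis
      by (metis BC matrix_mul_assoc matrix_mul_lid matrix_mul_rid)
  qed
  have NMt: "transpose N ** transpose M = mat 1"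
    by (metis MN matrix_transpose_mul transpose_mat)
  define A' where "A' = transpose M ** A ** M"
  define C' where "C' = N ** C ** transpose N"
  have Me: "M *v axis k 1 = column k M" for k
    by (simp add: matrix_vector_mul_component vec_eq_iff matrix_vector_mult_def column_def axis_def if_distrib cong: if_cong)
  have A'0: "A' $ k $ k = 0" for k
    using bform_axis[of A' k 1 k 1] vertex[of k] by (simp add: A'_def bform_congruence Me)
  have C'0: "C' $ k $ k = 0" for k
  proof -
    obtain p where p: "p \<noteq> 0" "bform B p p = 0" "\<And>j. j \<noteq> k \<Longrightarrow> bform B p (column j M) = 0"
      using side[of k] by blast
    \<comment> \<open>The polar line of \<open>p\<close> in coordinates dual to the vertices:
      \<open>y $ j\<close> is its equation evaluated at vertex j. Being the side opposite to vertex
      k, it is a multiple of the k-th axis vector.\<close>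
    define y where "y = transpose M *v (B *v p)"
    have yj: "y $ j = bform B p (column j M)" for j
    proof -
      have "bform B p (column j M) = (\<Sum>i\<in>UNIV. \<Sum>l\<in>UNIV. B $ i $ l * p $ i * M $ l $ j)"
        by (simp add: bform_def column_def)
      also have "\<dots> = (\<Sum>l\<in>UNIV. \<Sum>i\<in>UNIV. B $ i $ l * p $ i * M $ l $ j)"
        by (rule sum.swap)
      also have "\<dots> = (\<Sum>l\<in>UNIV. \<Sum>i\<in>UNIV. B $ l $ i * p $ i * M $ l $ j)"
        by (intro sum.cong refl arg_cong2[of _ _ _ _ "(*)"]) (rule sB)
      also have "\<dots> = y $ j"
        by (simp add: y_def matrix_vector_mult_def transpose_def sum_distrib_left mult_ac)
      finally show ?thesis by simp
    qed
    have y: "y = axis k (y $ k)"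
      using p(3) by (auto simp: vec_eq_iff axis_def yj)
    have py: "p = C ** transpose N *v y"
    proof -
      have "C ** transpose N *v y = C ** (transpose N ** transpose M) ** B *v p"
        by (simp add: y_def matrix_vector_mul_assoc matrix_mul_assoc)
      then show ?thesis by (simp add: NMt CB)
    qed
    \<comment> \<open>The dual form evaluated at the polar of \<open>p\<close> equals the form
      \<open>B\<close> at \<open>p\<close>; thus a line tangent at \<open>p\<close> is a zero of the
      dual form.\<close>
    have "transpose (C ** transpose N) ** B ** (C ** transpose N) = C'"
    proof -
      have "transpose (C ** transpose N) ** B ** (C ** transpose N) = N ** C ** (B ** C) ** transpose N"
        by (simp add: matrix_transpose_mul symC matrix_mul_assoc)
      then show ?thesis by (simp add: BC C'_def)
    qed
    then have "bform C' y y = bform B p p"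
      by (metis bform_congruence py)
    then have "(y $ k)\<^sup>2 * C' $ k $ k = 0"
      using p(2) y bform_axis[of C' k "y $ k" k "y $ k"] by (simp add: power2_eq_square)
    moreover have "y $ k \<noteq> 0"
      using p(1) py y by (metis axis_eq_0_iff matrix_vector_mult_0_right)
    ultimately show ?thesis by simp
  qed
  have sym': "transpose A' = A'" "transpose C' = C'"
    by (simp_all add: A'_def C'_def matrix_transpose_mul symA symC matrix_mul_assoc)
  \<comment> \<open>The inner factor \<open>M ** N\<close> cancels, so \<open>A ** C\<close> is
    conjugated by \<open>transpose M\<close>, whose inverse is \<open>transpose N\<close>; traces of
    its powers are unchanged.\<close>
  have X: "A' ** C' = transpose M ** (A ** C) ** transpose N"
  proof -
    have "A' ** C' = transpose M ** A ** (M ** N) ** C ** transpose N"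
      by (simp add: A'_def C'_def matrix_mul_assoc)
    then show ?thesis by (simp add: MN matrix_mul_assoc)
  qed
  have X2: "(A' ** C') ** (A' ** C') = transpose M ** ((A ** C) ** (A ** C)) ** transpose N"
  proof -
    have "(A' ** C') ** (A' ** C')
      = transpose M ** (A ** C) ** (transpose N ** transpose M) ** (A ** C) ** transpose N"
      by (simp only: X matrix_mul_assoc)
    then show ?thesis by (simp add: NMt matrix_mul_assoc)
  qed
  have tr: "trace (transpose M ** Y ** transpose N) = trace Y" for Y
  proof -
    have "trace (transpose M ** Y ** transpose N) = trace (Y ** transpose N ** transpose M)"
      by (metis matrix_mul_assoc trace_mul_sym)
    also have "Y ** transpose N ** transpose M = Y"
      by (metis NMt matrix_mul_assoc matrix_mul_rid)
    finally show ?thesis .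
  qed
  show ?thesis
    using trace_square_zero_diagonal[OF sym' A'0 C'0] unfolding X2 unfolding X tr .
qed

section \<open>Points, lines and triangles in the projective plane\<close>

lemma cp2_points_iff: "p \<in> cp2_points \<longleftrightarrow> (\<exists>v. v \<noteq> 0 \<and> p = vec.span {v})"
proof
  assume p: "p \<in> cp2_points"
  obtain B where B: "B \<subseteq> p" "vec.independent B" "p \<subseteq> vec.span B" "card B = vec.dim p"
    using vec.basis_exists[of p] by metis
  then obtain v where v: "B = {v}"
    using p by (auto simp: cp2_points_def card_1_singleton_iff)
  have "v \<noteq> 0"
    using B(2) v by (auto simp: vec.dependent_zero)
  moreover have "p = vec.span {v}"
  proof
    show "p \<subseteq> vec.span {v}" using B(3) v by simp
    show "vec.span {v} \<subseteq> p"
      using B(1) p unfolding v cp2_points_def by (intro vec.span_minimal) auto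
  qed
  ultimately show "\<exists>v. v \<noteq> 0 \<and> p = vec.span {v}" by blast
next
  assume "\<exists>v. v \<noteq> 0 \<and> p = vec.span {v}"
  then obtain v where "v \<noteq> 0" "p = vec.span {v}" by blast
  then show "p \<in> cp2_points"
    by (simp add: cp2_points_def vec.dim_eq_card_independent)
qed

lemma polar_span_singleton:
  "{w. \<forall>v\<in>vec.span {p}. bform A v w = 0} = {w. bform A p w = 0}"
proof -
  have "bform A (k *s p) w = k * bform A p w" for k w
    using bform_scale[of A k p 1 w] by simp
  then have "bform A v w = 0" if "v \<in> vec.span {p}" "bform A p w = 0" for v w
    using that by (auto simp: vec.span_singleton)
  moreover have "p \<in> vec.span {p}" by (simp add: vec.span_base)
  ultimately show ?thesis by blast
qed

lemma span_singleton_in_conic_locus: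
  assumes "v \<noteq> 0"
  shows "vec.span {v} \<in> conic_locus A \<longleftrightarrow> bform A v v = 0"
proof -
  have "bform A w w = 0" if "w \<in> vec.span {v}" "bform A v v = 0" for w
    using that by (auto simp: vec.span_singleton bform_scale)
  moreover have "v \<in> vec.span {v}" by (simp add: vec.span_base)
  moreover have "vec.span {v} \<in> cp2_points" using assms cp2_points_iff by blast
  ultimately show ?thesis unfolding conic_locus_def by blast
qed

lemma mem_span_pair: "w \<in> vec.span {u, v} \<longleftrightarrow> (\<exists>\<alpha> \<beta>. w = \<alpha> *s u + \<beta> *s v)"
proof -
  have "w - \<alpha> *s u = \<beta> *s v \<longleftrightarrow> w = \<alpha> *s u + \<beta> *s v" for \<alpha> \<beta>
    by (metis add_diff_cancel_left' diff_add_cancel add.commute)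
  then show ?thesis
    unfolding vec.span_breakdown_eq[of w u] vec.span_singleton image_iff by blast
qed

lemma join_span_singletons: "join (vec.span {u}) (vec.span {v}) = vec.span {u, v}"
proof -
  have "vec.span (vec.span {u} \<union> vec.span {v}) = vec.span ({u} \<union> {v})"
    by (auto simp: vec.span_eq intro: vec.span_base vec.span_mono[THEN subsetD, rotated])
  then show ?thesis by (simp add: join_def insert_commute)
qed

lemma span_singleton_eqI:
  assumes "a = k *s b" "a \<noteq> 0"
  shows "vec.span {a} = vec.span {b}"
proof -
  have "b = inverse k *s a" using assms by auto
  then have "b \<in> vec.span {a}"
    unfolding vec.span_singleton by (rule range_eqI)
  moreover have "a \<in> vec.span {b}"
    unfolding vec.span_singleton using assms(1) by (rule range_eqI)
  ultimately show ?thesis by (simp add: vec.span_eq)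
qed

text \<open>If \<beta> were 0, \<open>a\<close> would be a multiple of \<open>c\<close> and both
  would give the same point. Hence the relation can be solved for \<open>b\<close>. For three
  collinear points this makes two sides of the triangle coincide.\<close>

lemma span_pair_exchange:
  fixes a b c :: "'a::field ^ 'n"
  assumes eq: "a = \<beta> *s b + \<gamma> *s c" and "a \<noteq> 0" and "vec.span {a} \<noteq> vec.span {c}"
  shows "vec.span {b, c} = vec.span {a, c}"
proof -
  have "\<beta> \<noteq> 0"
    using assms span_singleton_eqI[of a \<gamma> c] by auto
  then have "b = inverse \<beta> *s a + (- inverse \<beta> * \<gamma>) *s c"
    by (simp add: eq vec.scale_right_distrib)
  then have "b \<in> vec.span {a, c}"
    unfolding mem_span_pair by blast
  moreover have "a \<in> vec.span {b, c}"
    unfolding mem_span_pair using eq by blast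
  ultimately show ?thesis
    by (simp add: vec.span_eq vec.span_base)
qed

text \<open>Stated for the triple and not for the set \<open>{a, b, c}\<close>, in which equal
  vectors would collapse; a triple with a repetition counts as dependent.\<close>

definition lin_indep3 :: "'a::field ^ 'n \<Rightarrow> 'a ^ 'n \<Rightarrow> 'a ^ 'n \<Rightarrow> bool" where
  "lin_indep3 a b c \<longleftrightarrow>
    (\<forall>\<alpha> \<beta> \<gamma>. \<alpha> *s a + \<beta> *s b + \<gamma> *s c = 0 \<longrightarrow> \<alpha> = 0 \<and> \<beta> = 0 \<and> \<gamma> = 0)"

lemma lin_indep3_rotate:
  assumes "lin_indep3 a b c"
  shows "lin_indep3 b c a"
  unfolding lin_indep3_def
proof (intro allI impI)
  fix \<alpha> \<beta> \<gamma> assume "\<alpha> *s b + \<beta> *s c + \<gamma> *s a = 0"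
  then have "\<gamma> *s a + \<alpha> *s b + \<beta> *s c = 0" by (simp add: ac_simps)
  then show "\<alpha> = 0 \<and> \<beta> = 0 \<and> \<gamma> = 0" using assms unfolding lin_indep3_def by blast
qed

lemma lin_indep3_notin_span:
  assumes "lin_indep3 a b c"
  shows "c \<notin> vec.span {a, b}"
proof
  assume "c \<in> vec.span {a, b}"
  then obtain \<alpha> \<beta> where "c = \<alpha> *s a + \<beta> *s b"
    unfolding mem_span_pair by blast
  then have "\<alpha> *s a + \<beta> *s b + (- 1) *s c = 0" by simp
  then show False using assms unfolding lin_indep3_def by fastforce
qed

lemma triangle_side_simps:
  "side 3 V 0 = join (V 0) (V 1)" "side 3 V 1 = join (V 1) (V 2)" "side 3 V 2 = join (V 2) (V 0)"
proof -
  have "Suc 0 mod 3 = 1" "Suc 1 mod 3 = 2" "Suc 2 mod 3 = 0" by simp_all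
  then show "side 3 V 0 = join (V 0) (V 1)" "side 3 V 1 = join (V 1) (V 2)"
    "side 3 V 2 = join (V 2) (V 0)"
    by (simp_all only: side_def)
qed

lemma lessThan_3: "{..<3} = {0, 1, 2::nat}"
  by auto

text \<open>For three points, distinctness of the vertices together with distinctness of the sides
  amounts to not being collinear: distinct collinear points have all their joins equal, and for
  independent vectors each vertex lies off the opposite side.\<close>

lemma is_polygon_triangle_iff:
  fixes v :: "nat \<Rightarrow> complex ^ 3"
  assumes V: "\<And>i. i < 3 \<Longrightarrow> V i = vec.span {v i}" and v: "\<And>i. i < 3 \<Longrightarrow> v i \<noteq> 0"
  shows "is_polygon 3 V \<longleftrightarrow> lin_indep3 (v 0) (v 1) (v 2)"
proof
  have polygon3: "is_polygon 3 V \<longleftrightarrow> (\<forall>i<3. V i \<in> cp2_points) \<and>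
    (V 0 \<noteq> V 1 \<and> V 1 \<noteq> V 2 \<and> V 2 \<noteq> V 0) \<and>
    (join (V 0) (V 1) \<noteq> join (V 1) (V 2) \<and> join (V 1) (V 2) \<noteq> join (V 2) (V 0)
      \<and> join (V 2) (V 0) \<noteq> join (V 0) (V 1))"
  proof -
    have inj: "inj_on f {..<3} \<longleftrightarrow> f 0 \<noteq> f 1 \<and> f 1 \<noteq> f 2 \<and> f 2 \<noteq> f 0" for f :: "nat \<Rightarrow> (complex ^ 3) set"
      by (auto simp: lessThan_3)
    show ?thesis
      unfolding is_polygon_def inj triangle_side_simps[of V] by simp
  qed
  have V': "V 0 = vec.span {v 0}" "V 1 = vec.span {v 1}" "V 2 = vec.span {v 2}"
    using V by simp_all
  have v': "v 0 \<noteq> 0" "v 1 \<noteq> 0" "v 2 \<noteq> 0"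
    using v by simp_all
  {
    assume "is_polygon 3 V"
    then have d: "vec.span {v 0} \<noteq> vec.span {v 1}" "vec.span {v 1} \<noteq> vec.span {v 2}"
        "vec.span {v 2} \<noteq> vec.span {v 0}"
      and s: "vec.span {v 0, v 1} \<noteq> vec.span {v 1, v 2}"
        "vec.span {v 1, v 2} \<noteq> vec.span {v 2, v 0}"
        "vec.span {v 2, v 0} \<noteq> vec.span {v 0, v 1}"
      unfolding polygon3 V' join_span_singletons by blast+
    have solve: "a = (- \<beta> / \<alpha>) *s b + (- \<gamma> / \<alpha>) *s c"
      if "\<alpha> *s a + \<beta> *s b + \<gamma> *s c = 0" "\<alpha> \<noteq> 0" for \<alpha> \<beta> \<gamma> and a b c :: "complex ^ 3"
    proof -
      have "\<alpha> * a $ i + \<beta> * b $ i + \<gamma> * c $ i = 0" for i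
        using arg_cong[OF that(1), of "\<lambda>x. x $ i"] by simp
      then have "\<alpha> * a $ i = - \<beta> * b $ i - \<gamma> * c $ i" for i
        by (simp add: add.assoc flip: eq_neg_iff_add_eq_0)
      then show ?thesis
        using that(2) by (simp add: vec_eq_iff field_simps)
    qed
    show "lin_indep3 (v 0) (v 1) (v 2)"
      unfolding lin_indep3_def
    proof (intro allI impI)
      fix \<alpha> \<beta> \<gamma> assume eq: "\<alpha> *s v 0 + \<beta> *s v 1 + \<gamma> *s v 2 = 0"
      have "\<beta> *s v 1 + \<gamma> *s v 2 + \<alpha> *s v 0 = 0" "\<gamma> *s v 2 + \<alpha> *s v 0 + \<beta> *s v 1 = 0"
        using eq by (simp_all add: ac_simps)
      note eqs = eq this
      \<comment> \<open>A nonzero coefficient would express \<open>v 0\<close> through the other two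
        vertices, and the exchange lemma would identify the side from \<open>v 1\<close> to
        \<open>v 2\<close> with the side from \<open>v 2\<close> to \<open>v 0\<close>. The other
        two coefficients follow cyclically.\<close>
      have "\<alpha> = 0"
        using span_pair_exchange[OF solve[OF eqs(1)] v'(1) d(3)[symmetric]] s(2) by (auto simp: insert_commute)
      moreover have "\<beta> = 0"
        using span_pair_exchange[OF solve[OF eqs(2)] v'(2) d(1)[symmetric]] s(3) by (auto simp: insert_commute)
      moreover have "\<gamma> = 0"
        using span_pair_exchange[OF solve[OF eqs(3)] v'(3) d(2)[symmetric]] s(1) by (auto simp: insert_commute)
      ultimately show "\<alpha> = 0 \<and> \<beta> = 0 \<and> \<gamma> = 0" by simp
    qed
  }
  assume li: "lin_indep3 (v 0) (v 1) (v 2)"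
  \<comment> \<open>Each vertex is off the line through the other two. Every inequality below is
    witnessed by a vertex that lies in one span and not in the other.\<close>
  note n = lin_indep3_notin_span[OF li] lin_indep3_notin_span[OF lin_indep3_rotate[OF li]]
    lin_indep3_notin_span[OF lin_indep3_rotate[OF lin_indep3_rotate[OF li]]]
  have mem: "x \<in> vec.span {x}" "x \<in> vec.span {x, y}" "x \<in> vec.span {y, x}" for x y :: "complex ^ 3"
    by (auto intro!: vec.span_base)
  have notin: "x \<notin> vec.span {y}" if "x \<notin> vec.span {y, z}" for x y z :: "complex ^ 3"
    using that vec.span_mono[of "{y}" "{y, z}"] by auto
  have "vec.span {v 0} \<noteq> vec.span {v 1}"
    using mem(1)[of "v 0"] notin[OF n(2)] by blast
  moreover have "vec.span {v 1} \<noteq> vec.span {v 2}"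
    using mem(1)[of "v 1"] notin[OF n(3)] by blast
  moreover have "vec.span {v 2} \<noteq> vec.span {v 0}"
    using mem(1)[of "v 2"] notin[OF n(1)] by blast
  moreover have "vec.span {v 0, v 1} \<noteq> vec.span {v 1, v 2}"
    using mem(2)[of "v 0" "v 1"] n(2) by blast
  moreover have "vec.span {v 1, v 2} \<noteq> vec.span {v 2, v 0}"
    using mem(2)[of "v 1" "v 2"] n(3) by blast
  moreover have "vec.span {v 2, v 0} \<noteq> vec.span {v 0, v 1}"
    using mem(2)[of "v 2" "v 0"] n(1) by blast
  moreover have "\<forall>i<3. V i \<in> cp2_points"
    using V v unfolding cp2_points_iff by blast
  ultimately show "is_polygon 3 V"
    unfolding polygon3 V' join_span_singletons by blast
qed

section \<open>Complexification of a real conic\<close>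

definition complex_vec :: "real ^ 'n \<Rightarrow> complex ^ 'n" where
  "complex_vec v = (\<chi> i. complex_of_real (v $ i))"

lemma complex_vec_nth [simp]: "complex_vec v $ i = complex_of_real (v $ i)"
  by (simp add: complex_vec_def)

lemma complex_vec_eq_0_iff: "complex_vec v = 0 \<longleftrightarrow> v = 0"
  by (simp add: vec_eq_iff)

lemma complex_matrix_nth [simp]: "complex_matrix A $ i $ j = complex_of_real (A $ i $ j)"
  by (simp add: complex_matrix_def)

lemma complex_matrix_mul: "complex_matrix (A ** B) = complex_matrix A ** complex_matrix B"
  by (simp add: vec_eq_iff matrix_matrix_mult_def)

lemma complex_matrix_transpose: "complex_matrix (transpose A) = transpose (complex_matrix A)"
  by (simp add: vec_eq_iff transpose_def)

lemma complex_matrix_mat_1: "complex_matrix (mat 1) = mat 1"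
  by (simp add: vec_eq_iff mat_def)

lemma complex_matrix_mult_complex_vec: "complex_matrix A *v complex_vec v = complex_vec (A *v v)"
  by (simp add: vec_eq_iff matrix_vector_mult_def)

lemma bform_complex_matrix:
  "bform (complex_matrix A) (complex_vec v) (complex_vec w) = complex_of_real (bform A v w)"
  by (simp add: bform_def)

lemma det_complex_matrix: "det (complex_matrix A) = complex_of_real (det A)"
  by (simp add: det_3)

text \<open>
  \<open>B\<close> ranges over complex matrices: \<open>tangent_line\<close> may present the complexified curve by any
  complex matrix, and all of these have to be multiples of \<open>Q\<close>.
\<close>

definition determines_conic :: "(real ^ 3) set \<Rightarrow> real ^ 3 ^ 3 \<Rightarrow> bool" where
  "determines_conic W Q \<longleftrightarrow> transpose Q = Q \<and> (\<forall>w\<in>W. bform Q w w = 0) \<and>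
    (\<forall>B. transpose B = B \<and> (\<forall>w\<in>W. bform B (complex_vec w) (complex_vec w) = 0) \<longrightarrow>
      (\<exists>c. \<forall>v w. bform B v w = c * bform (complex_matrix Q) v w))"

text \<open>A form vanishing on the image of \<open>W\<close> pulls back along \<open>T\<close> to a
  form vanishing on \<open>W\<close>, hence to a multiple of \<open>Q\<close>; substituting
  \<open>S\<close> turns this back into a statement about the image. It allows the circle and the
  parabola to be treated in adapted coordinates.\<close>

lemma determines_conic_congruence:
  assumes Q: "determines_conic W Q" and TS: "T ** S = mat 1" and ST: "S ** T = mat 1"
  shows "determines_conic ((*v) T ` W) (transpose S ** Q ** S)"
  unfolding determines_conic_def
proof (intro conjI ballI allI impI)
  show "transpose (transpose S ** Q ** S) = transpose S ** Q ** S"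
    using Q by (simp add: determines_conic_def matrix_transpose_mul matrix_mul_assoc)
  show "bform (transpose S ** Q ** S) w w = 0" if "w \<in> (*v) T ` W" for w
    using that Q by (auto simp: determines_conic_def bform_congruence matrix_vector_mul_assoc ST)
  fix B assume B: "transpose B = B \<and> (\<forall>w\<in>(*v) T ` W. bform B (complex_vec w) (complex_vec w) = 0)"
  let ?T = "complex_matrix T" and ?S = "complex_matrix S"
  have TS': "?T ** ?S = mat 1"
    using TS by (metis complex_matrix_mul complex_matrix_mat_1)
  have "transpose (transpose ?T ** B ** ?T) = transpose ?T ** B ** ?T"
    using B by (simp add: matrix_transpose_mul matrix_mul_assoc)
  moreover have "\<forall>w\<in>W. bform (transpose ?T ** B ** ?T) (complex_vec w) (complex_vec w) = 0"
    using B by (simp add: bform_congruence complex_matrix_mult_complex_vec)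
  ultimately obtain c where c: "bform (transpose ?T ** B ** ?T) v w = c * bform (complex_matrix Q) v w" for v w
    using Q unfolding determines_conic_def by blast
  have "bform B v w = c * bform (complex_matrix (transpose S ** Q ** S)) v w" for v w
    using c[of "?S *v v" "?S *v w"]
    by (simp add: complex_matrix_mul complex_matrix_transpose bform_congruence matrix_vector_mul_assoc TS')
  then show "\<exists>c. \<forall>v w. bform B v w = c * bform (complex_matrix (transpose S ** Q ** S)) v w"
    by blast
qed

text \<open>\<open>A\<close> is itself one of the equations that cut out the complexification, and
  every other one is a multiple of it.\<close>

lemma complexification_eq_conic_locus:
  assumes "determines_conic (homogeneous ` X) A"
  shows "complexification X = conic_locus (complex_matrix A)"
proof
  show "complexification X \<subseteq> conic_locus (complex_matrix A)"
    using assms unfolding complexification_def determines_conic_def by blast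
  show "conic_locus (complex_matrix A) \<subseteq> complexification X"
  proof
    fix p assume p: "p \<in> conic_locus (complex_matrix A)"
    have "p \<in> conic_locus (complex_matrix B)"
      if B: "transpose B = B" "\<forall>x\<in>X. bform B (homogeneous x) (homogeneous x) = 0" for B
    proof -
      have "transpose (complex_matrix B) = complex_matrix B"
        using B(1) by (simp flip: complex_matrix_transpose)
      moreover have "\<forall>w\<in>homogeneous ` X. bform (complex_matrix B) (complex_vec w) (complex_vec w) = 0"
        using B(2) by (simp add: bform_complex_matrix)
      ultimately obtain c where "bform (complex_matrix B) v w = c * bform (complex_matrix A) v w" for v w
        using assms unfolding determines_conic_def by blast
      with p show ?thesis by (simp add: conic_locus_def)
    qed
    with p show "p \<in> complexification X"
      unfolding complexification_def by (simp add: conic_locus_def)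
  qed
qed

section \<open>Tangent lines and their points of contact\<close>

lemma conic_locusE:
  assumes "p \<in> conic_locus A"
  obtains v where "v \<noteq> 0" "p = vec.span {v}" "bform A v v = 0"
proof -
  from assms obtain v where v: "v \<noteq> 0" "p = vec.span {v}"
    unfolding conic_locus_def cp2_points_iff by blast
  with assms have "bform A v v = 0"
    by (simp add: span_singleton_in_conic_locus)
  with v show thesis by (rule that)
qed

text \<open>The matrix \<open>B\<close> chosen in \<open>tangent_line\<close> has the same locus, so
  it vanishes on \<open>W\<close>, whose nonzero vectors represent points of that locus. It is
  therefore a multiple of \<open>A\<close>, and both define the same polar line.\<close>

lemma tangent_line_contact:
  assumes W: "determines_conic W A" "0 \<notin> W"
    and l: "tangent_line l (conic_locus (complex_matrix A))"
  shows "\<exists>p. p \<noteq> 0 \<and> bform (complex_matrix A) p p = 0 \<and> l = {w. bform (complex_matrix A) p w = 0}"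
proof -
  obtain B q where B: "transpose B = B" "det B \<noteq> 0"
    and locus: "conic_locus (complex_matrix A) = conic_locus B"
    and q: "q \<in> conic_locus (complex_matrix A)" "l = {w. \<forall>v\<in>q. bform B v w = 0}"
    using l unfolding tangent_line_def is_smooth_conic_matrix_def by blast
  obtain p where p: "p \<noteq> 0" "q = vec.span {p}" "bform (complex_matrix A) p p = 0"
    using conic_locusE[OF q(1)] .
  have "bform B (complex_vec w) (complex_vec w) = 0" if "w \<in> W" for w
  proof -
    have "complex_vec w \<noteq> 0"
      using that W(2) by (metis complex_vec_eq_0_iff)
    moreover have "bform (complex_matrix A) (complex_vec w) (complex_vec w) = 0"
      using that W(1) by (simp add: bform_complex_matrix determines_conic_def)
    ultimately show ?thesis
      using locus by (metis span_singleton_in_conic_locus)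
  qed
  then obtain c where c: "bform B v w = c * bform (complex_matrix A) v w" for v w
    using W(1) B(1) unfolding determines_conic_def by blast
  \<comment> \<open>Otherwise all entries of \<open>B\<close> would vanish, against
    \<open>det B\<close> being nonzero.\<close>
  have "c \<noteq> 0"
  proof
    assume "c = 0"
    then have "B $ i $ j = 0" for i j
      using c[of "axis i 1" "axis j 1"] by (simp add: bform_axis)
    then have "B = 0" by (simp add: vec_eq_iff)
    with B(2) show False by (simp add: det_3)
  qed
  then have "l = {w. bform (complex_matrix A) p w = 0}"
    unfolding q(2) p(2) polar_span_singleton by (simp add: c)
  with p show ?thesis by blast
qed

lemma tangent_line_polar:
  assumes "is_smooth_conic_matrix B" "p \<noteq> 0" "bform B p p = 0"
  shows "tangent_line {w. bform B p w = 0} (conic_locus B)"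
  unfolding tangent_line_def
proof (intro exI conjI bexI)
  show "{w. bform B p w = 0} = {w. \<forall>v\<in>vec.span {p}. bform B v w = 0}"
    by (simp only: polar_span_singleton)
  show "vec.span {p} \<in> conic_locus B"
    using assms by (simp add: span_singleton_in_conic_locus)
qed (use assms in auto)

section \<open>The circle and the parabola determined by five real points\<close>

definition sym3 :: "'a \<Rightarrow> 'a \<Rightarrow> 'a \<Rightarrow> 'a \<Rightarrow> 'a \<Rightarrow> 'a \<Rightarrow> 'a::zero ^ 3 ^ 3" where
  "sym3 a b c d e f = vector [vector [a, b, c], vector [b, d, e], vector [c, e, f]]"

lemma sym3_nth [simp]:
  "sym3 a b c d e f $ 1 $ 1 = a" "sym3 a b c d e f $ 1 $ 2 = b" "sym3 a b c d e f $ 1 $ 3 = c"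
  "sym3 a b c d e f $ 2 $ 1 = b" "sym3 a b c d e f $ 2 $ 2 = d" "sym3 a b c d e f $ 2 $ 3 = e"
  "sym3 a b c d e f $ 3 $ 1 = c" "sym3 a b c d e f $ 3 $ 2 = e" "sym3 a b c d e f $ 3 $ 3 = f"
  by (simp_all add: sym3_def)

lemma transpose_sym3: "transpose (sym3 a b c d e f) = sym3 a b c d e f"
  by (simp add: vec_eq_iff forall_3 transpose_def)

text \<open>The form of the circle with centre (u, v) and radius r. Its last diagonal entry is the
  power of the origin with respect to the circle.\<close>

definition circle_matrix :: "real \<Rightarrow> real \<Rightarrow> real \<Rightarrow> real ^ 3 ^ 3" where
  "circle_matrix u v r = sym3 1 0 (- u) 1 (- v) (u\<^sup>2 + v\<^sup>2 - r\<^sup>2)"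

text \<open>
  The parabola with focus at the origin whose directrix is the line \<open>y = - h\<close>: its equation
  \<open>x\<^sup>2 + y\<^sup>2 = (y + h)\<^sup>2\<close> is that of \<open>parabola_matrix h\<close>.
\<close>

definition parabola_matrix :: "real \<Rightarrow> real ^ 3 ^ 3" where
  "parabola_matrix h = sym3 1 0 0 0 (- h) (- h\<^sup>2)"

text \<open>The ends of the horizontal and the vertical diameter fix all coefficients up to the
  scale \<open>a\<close>, except that of xy. The fifth point, with rational coordinates from the
  triple 3, 4, 5, lies off both diameters and removes the xy term.\<close>

lemma circle_coefficients:
  fixes q :: "complex \<Rightarrow> complex \<Rightarrow> complex"
  assumes q: "\<And>x y. q x y = a * x * x + 2 * (b * x * y) + d * y * y + 2 * (c * x) + 2 * (e * y) + f"
    and r: "r \<noteq> 0"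
    and zero: "q (u + r) v = 0" "q (u - r) v = 0" "q u (v + r) = 0" "q u (v - r) = 0"
      "q (u + 3 / 5 * r) (v + 4 / 5 * r) = 0"
  shows "b = 0" "d = a" "c = - a * u" "e = - a * v" "f = a * (u\<^sup>2 + v\<^sup>2 - r\<^sup>2)"
proof -
  \<comment> \<open>In coordinates centred at (u, v), \<open>c'\<close> and \<open>e'\<close> are
    half the linear coefficients of \<open>q\<close>, and \<open>f'\<close> is its constant
    term.\<close>
  define c' where "c' = a * u + b * v + c"
  define e' where "e' = b * u + d * v + e"
  define f' where "f' = q u v"
  have shift: "q (u + s * r) (v + t * r)
    = r\<^sup>2 * (a * s\<^sup>2 + 2 * b * s * t + d * t\<^sup>2) + 2 * r * (c' * s + e' * t) + f'" for s t
    by (simp add: q c'_def e'_def f'_def power2_eq_square algebra_simps)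
  have z: "r\<^sup>2 * a + 2 * r * c' + f' = 0" "r\<^sup>2 * a - 2 * r * c' + f' = 0"
    "r\<^sup>2 * d + 2 * r * e' + f' = 0" "r\<^sup>2 * d - 2 * r * e' + f' = 0"
    "r\<^sup>2 * (a * (3/5)\<^sup>2 + 2 * b * (3/5) * (4/5) + d * (4/5)\<^sup>2) + 2 * r * (c' * (3/5) + e' * (4/5)) + f' = 0"
    using zero shift[of 1 0] shift[of "-1" 0] shift[of 0 1] shift[of 0 "-1"] shift[of "3/5" "4/5"] by simp_all
  have "4 * r * c' = 0" "4 * r * e' = 0"
    using z(1-4) by algebra+
  then have c': "c' = 0" and e': "e' = 0" using r by simp_all
  have f': "f' = - r\<^sup>2 * a"
    using z(1) c' by (simp add: eq_neg_iff_add_eq_0 add.commute)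
  have "r\<^sup>2 * (d - a) = 0"
    using z(3) e' f' by (simp add: algebra_simps)
  then show d: "d = a" using r by simp
  have "r\<^sup>2 * b = 0"
    using z(5) by (simp add: c' e' f' d power2_eq_square field_simps)
  then show b: "b = 0" using r by simp
  show c: "c = - a * u"
    using c' by (simp add: c'_def b eq_neg_iff_add_eq_0 add.commute)
  show e: "e = - a * v"
    using e' by (simp add: e'_def b d eq_neg_iff_add_eq_0 add.commute)
  show "f = a * (u\<^sup>2 + v\<^sup>2 - r\<^sup>2)"
    using f' unfolding f'_def q b c d e by algebra
qed

text \<open>The five points are the vertex, the two ends of the chord through the focus parallel to
  the directrix, and the symmetric pair with abscissas 2h and -2h. Differences within a symmetric
  pair isolate the coefficients of x and xy.\<close>

lemma parabola_coefficients:
  fixes q :: "complex \<Rightarrow> complex \<Rightarrow> complex"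
  assumes q: "\<And>x y. q x y = a * x * x + 2 * (b * x * y) + d * y * y + 2 * (c * x) + 2 * (e * y) + f"
    and h: "h \<noteq> 0"
    and zero: "q 0 (- h / 2) = 0" "q h 0 = 0" "q (- h) 0 = 0" "q (2 * h) (3 * h / 2) = 0"
      "q (- 2 * h) (3 * h / 2) = 0"
  shows "b = 0" "d = 0" "c = 0" "e = - a * h" "f = - a * h\<^sup>2"
proof -
  have z1: "d * h\<^sup>2 - 4 * h * e + 4 * f = 0"
    using zero(1) by (simp add: q power2_eq_square field_simps)
  have z2: "a * h\<^sup>2 + 2 * (c * h) + f = 0" "a * h\<^sup>2 - 2 * (c * h) + f = 0"
    using zero(2,3) by (simp_all add: q power2_eq_square mult.assoc)
  have z4: "16 * a * h\<^sup>2 + 24 * b * h\<^sup>2 + 9 * d * h\<^sup>2 + 16 * c * h + 12 * e * h + 4 * f = 0"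
    using zero(4) by (simp add: q power2_eq_square field_simps)
  have z5: "16 * a * h\<^sup>2 - 24 * b * h\<^sup>2 + 9 * d * h\<^sup>2 - 16 * c * h + 12 * e * h + 4 * f = 0"
    using zero(5) by (simp add: q power2_eq_square field_simps)
  have "4 * h * c = 0" using z2 by algebra
  then show c: "c = 0" using h by simp
  show f: "f = - a * h\<^sup>2" using z2(1) c by (simp add: eq_neg_iff_add_eq_0 add.commute)
  have "48 * h\<^sup>2 * b = 0" using z4 z5 c by algebra
  then show "b = 0" using h by simp
  \<comment> \<open>Half the sum of \<open>z4\<close> and \<open>z5\<close>, plus three times
    \<open>z1\<close>, eliminates \<open>e\<close>; the value of \<open>f\<close> then cancels
    \<open>a\<close>.\<close>
  have "12 * h\<^sup>2 * d = 0" using z1 z4 z5 f by algebra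
  then show d: "d = 0" using h by simp
  have "4 * h * (e + a * h) = 0" using z1 d f by algebra
  then show "e = - a * h" using h by (simp add: eq_neg_iff_add_eq_0)
qed

text \<open>The five points used are real points of the circle, where the complex form
  \<open>B\<close> is known to vanish. The factor is the x^2 coefficient of \<open>B\<close>, as the
  circle matrix has 1 in that place.\<close>

lemma determines_conic_circle:
  assumes "r > 0"
  shows "determines_conic {w. w $ 3 = 1 \<and> (w $ 1 - u)\<^sup>2 + (w $ 2 - v)\<^sup>2 = r\<^sup>2} (circle_matrix u v r)"
    (is "determines_conic ?W _")
  unfolding determines_conic_def
proof (intro conjI ballI allI impI)
  show "transpose (circle_matrix u v r) = circle_matrix u v r"
    by (simp add: circle_matrix_def transpose_sym3)
  show "bform (circle_matrix u v r) w w = 0" if "w \<in> ?W" for w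
    using that by (simp add: circle_matrix_def bform_def sum_3 power2_eq_square algebra_simps)
  fix B :: "complex ^ 3 ^ 3"
  assume B: "transpose B = B \<and> (\<forall>w\<in>?W. bform B (complex_vec w) (complex_vec w) = 0)"
  then have s: "B $ i $ j = B $ j $ i" for i j
    by (simp add: symmetric_matrix_nth)
  let ?u = "complex_of_real u" and ?v = "complex_of_real v" and ?r = "complex_of_real r"
  have q: "B $ 1 $ 1 * of_real x * of_real x + 2 * (B $ 1 $ 2 * of_real x * of_real y) + B $ 2 $ 2 * of_real y * of_real y
      + 2 * (B $ 1 $ 3 * of_real x) + 2 * (B $ 2 $ 3 * of_real y) + B $ 3 $ 3 = 0"
    if "(x - u)\<^sup>2 + (y - v)\<^sup>2 = r\<^sup>2" for x y
  proof -
    have "bform B (complex_vec (vector [x, y, 1])) (complex_vec (vector [x, y, 1])) = 0"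
      using B that by simp
    then show ?thesis
      by (simp add: bform_def sum_3 s[of 2 1] s[of 3 1] s[of 3 2] algebra_simps)
  qed
  define Q where "Q x y = B $ 1 $ 1 * x * x + 2 * (B $ 1 $ 2 * x * y) + B $ 2 $ 2 * y * y
      + 2 * (B $ 1 $ 3 * x) + 2 * (B $ 2 $ 3 * y) + B $ 3 $ 3" for x y
  have "?r \<noteq> 0" using assms by simp
  note coeffs = circle_coefficients[OF Q_def this, of ?u ?v]
  have "Q (?u + ?r) ?v = 0" "Q (?u - ?r) ?v = 0" "Q ?u (?v + ?r) = 0" "Q ?u (?v - ?r) = 0"
    "Q (?u + 3 / 5 * ?r) (?v + 4 / 5 * ?r) = 0"
    using q[of "u + r" v] q[of "u - r" v] q[of u "v + r"] q[of u "v - r"]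
      q[of "u + 3 / 5 * r" "v + 4 / 5 * r"]
    by (simp_all add: Q_def power_mult_distrib power_divide)
  note coeffs = coeffs[OF this]
  have "bform B x y = B $ 1 $ 1 * bform (complex_matrix (circle_matrix u v r)) x y" for x y
    unfolding bform_def sum_3 s[of 2 1] s[of 3 1] s[of 3 2] coeffs circle_matrix_def
    by (simp add: algebra_simps)
  then show "\<exists>c. \<forall>x y. bform B x y = c * bform (complex_matrix (circle_matrix u v r)) x y"
    by blast
qed

lemma determines_conic_parabola:
  assumes "h \<noteq> 0"
  shows "determines_conic {w. w $ 3 = 1 \<and> (w $ 1)\<^sup>2 = h\<^sup>2 + 2 * h * w $ 2} (parabola_matrix h)"
    (is "determines_conic ?W _")
  unfolding determines_conic_def
proof (intro conjI ballI allI impI)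
  show "transpose (parabola_matrix h) = parabola_matrix h"
    by (simp add: parabola_matrix_def transpose_sym3)
  show "bform (parabola_matrix h) w w = 0" if "w \<in> ?W" for w
    using that by (simp add: parabola_matrix_def bform_def sum_3 power2_eq_square algebra_simps)
  fix B :: "complex ^ 3 ^ 3"
  assume B: "transpose B = B \<and> (\<forall>w\<in>?W. bform B (complex_vec w) (complex_vec w) = 0)"
  then have s: "B $ i $ j = B $ j $ i" for i j
    by (simp add: symmetric_matrix_nth)
  let ?h = "complex_of_real h"
  have q: "B $ 1 $ 1 * of_real x * of_real x + 2 * (B $ 1 $ 2 * of_real x * of_real y) + B $ 2 $ 2 * of_real y * of_real y
      + 2 * (B $ 1 $ 3 * of_real x) + 2 * (B $ 2 $ 3 * of_real y) + B $ 3 $ 3 = 0"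
    if "x\<^sup>2 = h\<^sup>2 + 2 * h * y" for x y
  proof -
    have "bform B (complex_vec (vector [x, y, 1])) (complex_vec (vector [x, y, 1])) = 0"
      using B that by simp
    then show ?thesis
      by (simp add: bform_def sum_3 s[of 2 1] s[of 3 1] s[of 3 2] algebra_simps)
  qed
  define Q where "Q x y = B $ 1 $ 1 * x * x + 2 * (B $ 1 $ 2 * x * y) + B $ 2 $ 2 * y * y
      + 2 * (B $ 1 $ 3 * x) + 2 * (B $ 2 $ 3 * y) + B $ 3 $ 3" for x y
  have "?h \<noteq> 0" using assms by simp
  note coeffs = parabola_coefficients[OF Q_def this]
  have "Q 0 (- ?h / 2) = 0" "Q ?h 0 = 0" "Q (- ?h) 0 = 0" "Q (2 * ?h) (3 * ?h / 2) = 0"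
      "Q (- 2 * ?h) (3 * ?h / 2) = 0"
    using q[of 0 "- h / 2"] q[of h 0] q[of "- h" 0] q[of "2 * h" "3 * h / 2"] q[of "- 2 * h" "3 * h / 2"]
    by (simp_all add: Q_def power2_eq_square)
  note coeffs = coeffs[OF this]
  have "bform B x y = B $ 1 $ 1 * bform (complex_matrix (parabola_matrix h)) x y" for x y
    unfolding bform_def sum_3 s[of 2 1] s[of 3 1] s[of 3 2] coeffs parabola_matrix_def
    by (simp add: algebra_simps)
  then show "\<exists>c. \<forall>v w. bform B v w = c * bform (complex_matrix (parabola_matrix h)) v w"
    by blast
qed

section \<open>Circle and parabola in coordinates adapted to the directrix\<close>

text \<open>Rewrites tangency of a side as equations for its point of contact, the form in which the
  trace identity takes its hypothesis on sides.\<close>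

lemma tangent_line_side_contact:
  assumes "determines_conic W A" "0 \<notin> W"
    and "tangent_line (join (vec.span {u}) (vec.span {v})) (conic_locus (complex_matrix A))"
  shows "\<exists>p. p \<noteq> 0 \<and> bform (complex_matrix A) p p = 0 \<and>
    bform (complex_matrix A) p u = 0 \<and> bform (complex_matrix A) p v = 0"
proof -
  obtain p where p: "p \<noteq> 0" "bform (complex_matrix A) p p = 0"
    "vec.span {u, v} = {w. bform (complex_matrix A) p w = 0}"
    using tangent_line_contact[OF assms] unfolding join_span_singletons by blast
  have "u \<in> vec.span {u, v}" "v \<in> vec.span {u, v}"
    by (auto intro: vec.span_base)
  with p show ?thesis unfolding p(3) by blast
qed

lemma lin_indep3_image:
  assumes li: "lin_indep3 a b c" and ST: "S ** T = mat 1"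
  shows "lin_indep3 (T *v a) (T *v b) (T *v c)"
  unfolding lin_indep3_def
proof (intro allI impI)
  fix \<alpha> \<beta> \<gamma> assume "\<alpha> *s (T *v a) + \<beta> *s (T *v b) + \<gamma> *s (T *v c) = 0"
  then have "T *v (\<alpha> *s a + \<beta> *s b + \<gamma> *s c) = 0"
    by (simp add: vec.add vec.scale)
  then have "S *v (T *v (\<alpha> *s a + \<beta> *s b + \<gamma> *s c)) = 0"
    by simp
  then have "\<alpha> *s a + \<beta> *s b + \<gamma> *s c = 0"
    by (simp only: matrix_vector_mul_assoc ST matrix_vector_mul_lid)
  then show "\<alpha> = 0 \<and> \<beta> = 0 \<and> \<gamma> = 0"
    using li unfolding lin_indep3_def by blast
qed

lemma triangle_circle_parabola:
  assumes li: "lin_indep3 a b c" and h: "h \<noteq> 0"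
    and vertex: "bform (complex_matrix (circle_matrix u v r)) a a = 0"
      "bform (complex_matrix (circle_matrix u v r)) b b = 0"
      "bform (complex_matrix (circle_matrix u v r)) c c = 0"
    and side: "\<exists>p. p \<noteq> 0 \<and> bform B p p = 0 \<and> bform B p b = 0 \<and> bform B p c = 0"
      "\<exists>p. p \<noteq> 0 \<and> bform B p p = 0 \<and> bform B p a = 0 \<and> bform B p c = 0"
      "\<exists>p. p \<noteq> 0 \<and> bform B p p = 0 \<and> bform B p a = 0 \<and> bform B p b = 0"
    and B: "B = complex_matrix (parabola_matrix h)"
  shows "u\<^sup>2 + v\<^sup>2 = r\<^sup>2"
proof -
  define M :: "complex ^ 3 ^ 3" where "M = (\<chi> i j. vector [a, b, c] $ j $ i)"
  have col: "column 1 M = a" "column 2 M = b" "column 3 M = c"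
    by (simp_all add: column_def M_def vec_eq_iff)
  have "x = 0" if "M *v x = 0" for x
  proof -
    have "x $ 1 *s a + x $ 2 *s b + x $ 3 *s c = M *v x"
      by (simp add: vec_eq_iff matrix_vector_mult_def M_def sum_3 mult.commute)
    with that have "x $ 1 *s a + x $ 2 *s b + x $ 3 *s c = 0" by simp
    with li have "x $ 1 = 0 \<and> x $ 2 = 0 \<and> x $ 3 = 0"
      unfolding lin_indep3_def by blast
    then show ?thesis by (simp add: vec_eq_iff forall_3)
  qed
  then have M: "invertible M"
    unfolding invertible_left_inverse matrix_left_invertible_ker by blast
  let ?A = "complex_matrix (circle_matrix u v r)"
  define h' where "h' = complex_of_real h"
  have h': "h' \<noteq> 0" using h by (simp add: h'_def)
  define g where "g = inverse h'"
  \<comment> \<open>The inverse of \<open>B\<close>, that is, the dual conic. Its last diagonal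
    entry is 0 because the line at infinity is tangent to the parabola.\<close>
  define C where "C = sym3 1 0 0 1 (- g) 0"
  have A_eq: "?A = sym3 1 0 (- of_real u) 1 (- of_real v) (of_real (u\<^sup>2 + v\<^sup>2 - r\<^sup>2))"
    by (simp add: vec_eq_iff forall_3 circle_matrix_def)
  have B_eq: "B = sym3 1 0 0 0 (- h') (- h'\<^sup>2)"
    by (simp add: vec_eq_iff forall_3 B parabola_matrix_def h'_def)
  have BC: "B ** C = mat 1"
    using h' by (simp add: B_eq C_def g_def vec_eq_iff forall_3 matrix_matrix_mult_def sum_3 mat_def power2_eq_square)
  have "(trace (?A ** C))\<^sup>2 = 2 * trace ((?A ** C) ** (?A ** C))"
  proof (rule triangle_trace_identity[OF _ _ BC M])
    show "transpose ?A = ?A" "transpose B = B"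
      by (simp_all add: A_eq B_eq transpose_sym3)
    show "bform ?A (column k M) (column k M) = 0" for k
      using exhaust_3[of k] vertex by (auto simp: col)
    have side': "\<forall>k. \<exists>p. p \<noteq> 0 \<and> bform B p p = 0 \<and> (\<forall>j. j \<noteq> k \<longrightarrow> bform B p (column j M) = 0)"
      unfolding forall_3 col using side by simp
    then show "\<exists>p. p \<noteq> 0 \<and> bform B p p = 0 \<and> (\<forall>j. j \<noteq> k \<longrightarrow> bform B p (column j M) = 0)" for k
      by blast
  qed
  \<comment> \<open>The defect of the trace identity is a nonzero multiple of the power of the
    origin, which is the focus of this parabola.\<close>
  moreover have "(trace (?A ** C))\<^sup>2 - 2 * trace ((?A ** C) ** (?A ** C))
    = - 4 * g\<^sup>2 * of_real (u\<^sup>2 + v\<^sup>2 - r\<^sup>2)"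
    unfolding A_eq C_def trace_def matrix_matrix_mult_def
    by (simp add: sum_3 power2_eq_square algebra_simps)
  ultimately have "of_real (u\<^sup>2 + v\<^sup>2 - r\<^sup>2) = (0 :: complex)"
    using h' unfolding g_def by simp
  then have "u\<^sup>2 + v\<^sup>2 - r\<^sup>2 = 0" unfolding of_real_eq_0_iff .
  then show ?thesis by simp
qed

section \<open>Distance to a line and an orthonormal frame at the focus\<close>

lemma hyperplane_of_line:
  fixes l :: "(real ^ 2) set"
  assumes "affine l" "aff_dim l = 1"
  obtains a d where "norm a = 1" "l = {x. a \<bullet> x = d}"
proof -
  obtain a d where a: "a \<noteq> 0" "l = {x. a \<bullet> x = d}"
    using aff_dim_eq_hyperplane[of l] assms by (auto simp: hull_same)
  show thesis
  proof (rule that[of "a /\<^sub>R norm a" "d / norm a"])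
    show "norm (a /\<^sub>R norm a) = 1" using a(1) by simp
    show "l = {x. (a /\<^sub>R norm a) \<bullet> x = d / norm a}"
      using a by (simp add: field_simps)
  qed
qed

text \<open>The foot of the perpendicular attains the value, and Cauchy-Schwarz applied to
  \<open>a\<close> and \<open>x - z\<close> bounds the distance to every other point from
  below.\<close>

lemma infdist_hyperplane:
  fixes a x :: "'a::euclidean_space"
  assumes a: "norm a = 1"
  shows "infdist x {x. a \<bullet> x = d} = \<bar>a \<bullet> x - d\<bar>"
proof (rule antisym)
  have aa: "a \<bullet> a = 1" using a by (simp add: dot_square_norm)
  let ?y = "x - (a \<bullet> x - d) *\<^sub>R a"
  have y: "a \<bullet> ?y = d" by (simp add: inner_diff_right aa)
  then have "infdist x {x. a \<bullet> x = d} \<le> dist x ?y"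
    by (intro infdist_le) simp
  then show "infdist x {x. a \<bullet> x = d} \<le> \<bar>a \<bullet> x - d\<bar>"
    by (simp add: dist_norm a)
  have "\<bar>a \<bullet> x - d\<bar> \<le> dist x z" if "a \<bullet> z = d" for z
  proof -
    have "\<bar>a \<bullet> (x - z)\<bar> \<le> norm a * norm (x - z)" by (rule Cauchy_Schwarz_ineq2)
    then show ?thesis using that by (simp add: inner_diff_right a dist_norm)
  qed
  moreover have "{x. a \<bullet> x = d} \<noteq> {}" using y by blast
  ultimately show "\<bar>a \<bullet> x - d\<bar> \<le> infdist x {x. a \<bullet> x = d}"
    by (auto simp: infdist_def intro!: cINF_greatest)
qed

text \<open>
  The columns of \<open>frame a f\<close> are the direction orthogonal to the unit vector \<open>a\<close>, the direction of
  \<open>a\<close>, and the point \<open>f\<close>; \<open>coframe a f\<close> is its inverse.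
\<close>

definition frame :: "real ^ 2 \<Rightarrow> real ^ 2 \<Rightarrow> real ^ 3 ^ 3" where
  "frame a f = vector [vector [- a $ 2, a $ 1, f $ 1], vector [a $ 1, a $ 2, f $ 2], vector [0, 0, 1]]"

definition coframe :: "real ^ 2 \<Rightarrow> real ^ 2 \<Rightarrow> real ^ 3 ^ 3" where
  "coframe a f = vector [vector [- a $ 2, a $ 1, a $ 2 * f $ 1 - a $ 1 * f $ 2],
    vector [a $ 1, a $ 2, - (a $ 1 * f $ 1 + a $ 2 * f $ 2)], vector [0, 0, 1]]"

lemma inner_real2: "x \<bullet> y = x $ 1 * y $ 1 + x $ 2 * y $ 2" for x y :: "real ^ 2"
  by (simp add: inner_vec_def sum_2)

lemma dist_real2_squared: "(dist x y)\<^sup>2 = (x $ 1 - y $ 1)\<^sup>2 + (x $ 2 - y $ 2)\<^sup>2" for x y :: "real ^ 2"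
  unfolding dist_norm power2_norm_eq_inner by (simp add: inner_real2 power2_eq_square)

lemma unit_real2: "norm a = 1 \<Longrightarrow> (a $ 1)\<^sup>2 + (a $ 2)\<^sup>2 = 1" for a :: "real ^ 2"
  using power2_norm_eq_inner[of a] by (simp add: inner_real2 power2_eq_square)

lemma frame_coframe:
  assumes "norm a = 1"
  shows "frame a f ** coframe a f = mat 1" "coframe a f ** frame a f = mat 1"
proof -
  have n: "a $ 1 * a $ 1 + a $ 2 * a $ 2 = 1" using unit_real2[OF assms] by (simp add: power2_eq_square)
  then show "coframe a f ** frame a f = mat 1"
    by (simp add: vec_eq_iff forall_3 matrix_matrix_mult_def sum_3 mat_def frame_def coframe_def algebra_simps)
  then show "frame a f ** coframe a f = mat 1"
    by (simp add: matrix_left_right_inverse)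
qed

lemma coframe_homogeneous:
  "coframe a f *v homogeneous x
    = vector [a $ 1 * (x $ 2 - f $ 2) - a $ 2 * (x $ 1 - f $ 1), a \<bullet> (x - f), 1]"
  by (simp add: vec_eq_iff forall_3 matrix_vector_mult_def sum_3 coframe_def homogeneous_def
      inner_real2 algebra_simps)

text \<open>The last row of \<open>frame a f\<close> is (0, 0, 1), so vectors with third coordinate
  1 are mapped to such vectors. An affine curve can thus be described by its equation in frame
  coordinates.\<close>

lemma homogeneous_image_eq:
  assumes a: "norm a = 1" and W: "\<And>w. w \<in> W \<Longrightarrow> w $ 3 = 1"
    and X: "\<And>x. x \<in> X \<longleftrightarrow> coframe a f *v homogeneous x \<in> W"
  shows "homogeneous ` X = (*v) (frame a f) ` W"
proof (intro equalityI subsetI)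
  fix y assume "y \<in> homogeneous ` X"
  then obtain x where x: "x \<in> X" "y = homogeneous x" by blast
  then have "y = frame a f *v (coframe a f *v homogeneous x)"
    by (simp add: matrix_vector_mul_assoc frame_coframe[OF a])
  then show "y \<in> (*v) (frame a f) ` W" using x X by blast
next
  fix y assume "y \<in> (*v) (frame a f) ` W"
  then obtain w where w: "w \<in> W" "y = frame a f *v w" by blast
  define x :: "real ^ 2" where "x = vector [y $ 1, y $ 2]"
  have "y $ 3 = 1"
    using W[OF w(1)] by (simp add: w(2) frame_def matrix_vector_mult_def sum_3)
  then have y: "y = homogeneous x"
    by (simp add: homogeneous_def x_def vec_eq_iff forall_3)
  have "coframe a f *v homogeneous x = w"
    by (simp add: y[symmetric] w(2) matrix_vector_mul_assoc frame_coframe[OF a])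
  then show "y \<in> homogeneous ` X" using X w(1) y by blast
qed

lemma determines_conic_sphere:
  assumes "norm a = 1" "r > 0"
    and uv: "u = a $ 1 * (c $ 2 - f $ 2) - a $ 2 * (c $ 1 - f $ 1)" "v = a \<bullet> (c - f)"
  shows "determines_conic (homogeneous ` sphere c r)
    (transpose (coframe a f) ** circle_matrix u v r ** coframe a f)"
proof -
  let ?W = "{w :: real ^ 3. w $ 3 = 1 \<and> (w $ 1 - u)\<^sup>2 + (w $ 2 - v)\<^sup>2 = r\<^sup>2}"
  have "homogeneous ` sphere c r = (*v) (frame a f) ` ?W"
  proof (rule homogeneous_image_eq[OF assms(1)])
    fix x :: "real ^ 2"
    let ?w = "coframe a f *v homogeneous x"
    \<comment> \<open>Lagrange's identity: since (u, v) are the frame coordinates of the centre,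
      distances from it are scaled by the norm of \<open>a\<close>, which is 1.\<close>
    have "(?w $ 1 - u)\<^sup>2 + (?w $ 2 - v)\<^sup>2 = ((a $ 1)\<^sup>2 + (a $ 2)\<^sup>2) * (dist x c)\<^sup>2"
      unfolding coframe_homogeneous dist_real2_squared uv
      by (simp add: inner_real2 power2_eq_square algebra_simps)
    moreover have "x \<in> sphere c r \<longleftrightarrow> (dist x c)\<^sup>2 = r\<^sup>2"
      using \<open>r > 0\<close> by (simp add: dist_commute)
    ultimately show "x \<in> sphere c r \<longleftrightarrow> ?w \<in> ?W"
      by (simp add: unit_real2[OF assms(1)] coframe_homogeneous)
  qed simp
  then show ?thesis
    using determines_conic_congruence[OF determines_conic_circle[OF \<open>r > 0\<close>] frame_coframe[OF assms(1)]]
    by simp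
qed

lemma determines_conic_focus_directrix:
  assumes "norm a = 1" and h: "h = a \<bullet> f - d" "h \<noteq> 0"
  shows "determines_conic (homogeneous ` {x. dist x f = infdist x {x. a \<bullet> x = d}})
    (transpose (coframe a f) ** parabola_matrix h ** coframe a f)"
proof -
  let ?W = "{w :: real ^ 3. w $ 3 = 1 \<and> (w $ 1)\<^sup>2 = h\<^sup>2 + 2 * h * w $ 2}"
  have "homogeneous ` {x. dist x f = infdist x {x. a \<bullet> x = d}} = (*v) (frame a f) ` ?W"
  proof (rule homogeneous_image_eq[OF assms(1)])
    fix x :: "real ^ 2"
    let ?w = "coframe a f *v homogeneous x"
    have "(?w $ 1)\<^sup>2 + (?w $ 2)\<^sup>2 = ((a $ 1)\<^sup>2 + (a $ 2)\<^sup>2) * (dist x f)\<^sup>2"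
      unfolding coframe_homogeneous dist_real2_squared
      by (simp add: inner_real2 power2_eq_square algebra_simps)
    \<comment> \<open>The signed distance from the directrix, which in frame coordinates is the line
      y = -h. Squaring the focal condition then cancels the square of the second coordinate.\<close>
    moreover have "a \<bullet> x - d = ?w $ 2 + h"
      by (simp add: coframe_homogeneous h(1) inner_diff_right)
    moreover have "dist x f = infdist x {x. a \<bullet> x = d} \<longleftrightarrow> (dist x f)\<^sup>2 = (a \<bullet> x - d)\<^sup>2"
      unfolding infdist_hyperplane[OF assms(1)]
      using power2_eq_iff_nonneg[of "dist x f" "\<bar>a \<bullet> x - d\<bar>"] by simp
    ultimately have "dist x f = infdist x {x. a \<bullet> x = d} \<longleftrightarrow> (?w $ 1)\<^sup>2 = h\<^sup>2 + 2 * h * ?w $ 2"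
      by (auto simp: unit_real2[OF assms(1)] power2_sum algebra_simps)
    then show "x \<in> {x. dist x f = infdist x {x. a \<bullet> x = d}} \<longleftrightarrow> ?w \<in> ?W"
      by (simp add: coframe_homogeneous)
  qed simp
  then show ?thesis
    using determines_conic_congruence[OF determines_conic_parabola[OF h(2)] frame_coframe[OF assms(1)]]
    by simp
qed

section \<open>The isotropic triangle\<close>

lemma homogeneous_neq_0: "0 \<notin> homogeneous ` X"
proof
  assume "0 \<in> homogeneous ` X"
  then obtain x where "0 = homogeneous x" by blast
  then have "(0 :: real ^ 3) $ 3 = homogeneous x $ 3" by simp
  then show False by (simp add: homogeneous_def)
qed

section \<open>Transport of tangent lines between coordinate systems\<close>

lemma det_congruence: "det (transpose S ** A ** S) = (det S)\<^sup>2 * det A"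
  by (simp add: det_mul power2_eq_square)

lemma bform_complex_congruence:
  "bform (complex_matrix (transpose S ** A ** S)) v w
    = bform (complex_matrix A) (complex_matrix S *v v) (complex_matrix S *v w)"
  by (simp add: complex_matrix_mul complex_matrix_transpose bform_congruence)

lemma span_pair_frame:
  assumes TS: "T ** S = mat 1" and ST: "S ** T = mat 1"
    and line: "vec.span {u, v} = {w. bform (complex_matrix Q) p w = 0}"
  shows "vec.span {complex_matrix T *v u, complex_matrix T *v v}
    = {w. bform (complex_matrix (transpose S ** Q ** S)) (complex_matrix T *v p) w = 0}"
proof -
  let ?T = "complex_matrix T" and ?S = "complex_matrix S"
  have ST': "?S *v (?T *v w) = w" and TS': "?T *v (?S *v w) = w" for w
    by (metis TS ST complex_matrix_mul complex_matrix_mat_1 matrix_vector_mul_assoc matrix_vector_mul_lid)+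
  have "w \<in> vec.span {?T *v u, ?T *v v} \<longleftrightarrow> ?S *v w \<in> vec.span {u, v}" for w
  proof
    assume "w \<in> vec.span {?T *v u, ?T *v v}"
    then obtain \<alpha> \<beta> where "w = \<alpha> *s (?T *v u) + \<beta> *s (?T *v v)"
      unfolding mem_span_pair by blast
    then have "?S *v w = \<alpha> *s u + \<beta> *s v"
      by (simp add: vec.add vec.scale ST')
    then show "?S *v w \<in> vec.span {u, v}" unfolding mem_span_pair by blast
  next
    assume "?S *v w \<in> vec.span {u, v}"
    then obtain \<alpha> \<beta> where "?S *v w = \<alpha> *s u + \<beta> *s v"
      unfolding mem_span_pair by blast
    then have "?T *v (?S *v w) = \<alpha> *s (?T *v u) + \<beta> *s (?T *v v)"
      by (simp add: vec.add vec.scale)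
    then show "w \<in> vec.span {?T *v u, ?T *v v}"
      unfolding TS' mem_span_pair by blast
  qed
  then show ?thesis
    unfolding line bform_complex_congruence ST' by blast
qed

text \<open>Carries a tangent side computed in frame coordinates, together with its point of contact
  \<open>p\<close>, to the original coordinates.\<close>

lemma tangent_side_frame:
  assumes TS: "T ** S = mat 1" and ST: "S ** T = mat 1"
    and smooth: "is_smooth_conic_matrix (complex_matrix (transpose S ** Q ** S))"
    and line: "vec.span {u, v} = {w. bform (complex_matrix Q) p w = 0}"
    and p: "p \<noteq> 0" "bform (complex_matrix Q) p p = 0"
  shows "tangent_line (join (vec.span {complex_matrix T *v u}) (vec.span {complex_matrix T *v v}))
    (conic_locus (complex_matrix (transpose S ** Q ** S)))"
proof -
  have ST': "complex_matrix S *v (complex_matrix T *v w) = w" for w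
    by (metis ST complex_matrix_mul complex_matrix_mat_1 matrix_vector_mul_assoc matrix_vector_mul_lid)
  show ?thesis
    unfolding join_span_singletons span_pair_frame[OF TS ST line]
  proof (rule tangent_line_polar[OF smooth])
    show "complex_matrix T *v p \<noteq> 0"
      using p(1) by (metis ST' matrix_vector_mult_0_right)
    show "bform (complex_matrix (transpose S ** Q ** S)) (complex_matrix T *v p) (complex_matrix T *v p) = 0"
      using p(2) by (simp add: bform_complex_congruence ST')
  qed
qed

text \<open>The vectors are the two circular points at infinity and, last, the focus, all in frame
  coordinates.\<close>

lemma isotropic_triangle_lin_indep3:
  "lin_indep3 (vector [\<i>, 1, 0]) (vector [- \<i>, 1, 0]) (vector [0, 0, 1] :: complex ^ 3)"
  unfolding lin_indep3_def
proof (intro allI impI)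
  fix \<alpha> \<beta> \<gamma>
  assume eq: "\<alpha> *s vector [\<i>, 1, 0] + \<beta> *s vector [- \<i>, 1, 0] + \<gamma> *s (vector [0, 0, 1] :: complex ^ 3) = 0"
  have 1: "\<alpha> = \<beta>" using arg_cong[OF eq, of "\<lambda>x. x $ 1"] by simp
  have "\<alpha> + \<beta> = 0" using arg_cong[OF eq, of "\<lambda>x. x $ 2"] by simp
  then have "2 * \<beta> = 0" unfolding 1 by (simp only: mult_2)
  moreover have "\<gamma> = 0" using arg_cong[OF eq, of "\<lambda>x. x $ 3"] by simp
  ultimately show "\<alpha> = 0 \<and> \<beta> = 0 \<and> \<gamma> = 0" using 1 by simp
qed

text \<open>The sides are the line at infinity and the two isotropic lines through the focus. The
  line at infinity touches the parabola at the point at infinity of its axis. The isotropic lines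
  touch it at imaginary points of the directrix, the polar of the focus.\<close>

lemma isotropic_triangle_sides:
  fixes h :: real
  assumes h: "h \<noteq> 0"
  defines "B \<equiv> complex_matrix (parabola_matrix h)"
  shows "vec.span {vector [\<i>, 1, 0], vector [- \<i>, 1, 0]} = {w. bform B (vector [0, 1, 0]) w = 0}"
    and "vec.span {vector [- \<i>, 1, 0], vector [0, 0, 1]}
      = {w. bform B (vector [- \<i> * of_real h, of_real h, - 1]) w = 0}"
    and "vec.span {vector [0, 0, 1], vector [\<i>, 1, 0]}
      = {w. bform B (vector [\<i> * of_real h, of_real h, - 1]) w = 0}"
proof -
  define h' where "h' = complex_of_real h"
  have h': "h' \<noteq> 0" using h by (simp add: h'_def)
  have b: "bform B x w = x $ 1 * w $ 1 - h' * (x $ 2 * w $ 3 + x $ 3 * w $ 2) - h'\<^sup>2 * x $ 3 * w $ 3" for x w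
    by (simp add: B_def parabola_matrix_def bform_def sum_3 h'_def algebra_simps)
  have ii: "\<i> * z * \<i> = - z" "\<i> * (z * \<i>) = - z" for z
    by (simp_all add: mult.commute flip: mult.assoc)
  have b1: "bform B (vector [0, 1, 0]) w = - h' * w $ 3" for w
    by (simp add: b)
  have b2: "bform B (vector [- \<i> * h', h', - 1]) w = h' * (w $ 2 - \<i> * w $ 1)" for w
    by (simp add: b power2_eq_square algebra_simps)
  have b3: "bform B (vector [\<i> * h', h', - 1]) w = h' * (w $ 2 + \<i> * w $ 1)" for w
    by (simp add: b power2_eq_square algebra_simps)
  have "w \<in> vec.span {vector [\<i>, 1, 0], vector [- \<i>, 1, 0]} \<longleftrightarrow> w $ 3 = 0" for w :: "complex ^ 3"
  proof
    assume "w $ 3 = 0"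
    \<comment> \<open>The coefficients solve the linear system given by the first two
      coordinates.\<close>
    then have "w = ((w $ 2 - \<i> * w $ 1) / 2) *s vector [\<i>, 1, 0] + ((w $ 2 + \<i> * w $ 1) / 2) *s vector [- \<i>, 1, 0]"
      by (simp add: vec_eq_iff forall_3 field_simps)
    then show "w \<in> vec.span {vector [\<i>, 1, 0], vector [- \<i>, 1, 0]}"
      unfolding mem_span_pair by blast
  qed (auto simp: mem_span_pair ii)
  then show "vec.span {vector [\<i>, 1, 0], vector [- \<i>, 1, 0]} = {w. bform B (vector [0, 1, 0]) w = 0}"
    using h' by (auto simp: b1)
  have "w \<in> vec.span {vector [- \<i>, 1, 0], vector [0, 0, 1]} \<longleftrightarrow> w $ 2 - \<i> * w $ 1 = 0" for w :: "complex ^ 3"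
  proof
    assume "w $ 2 - \<i> * w $ 1 = 0"
    then have "w $ 2 = \<i> * w $ 1" by simp
    then have "w = w $ 2 *s vector [- \<i>, 1, 0] + w $ 3 *s vector [0, 0, 1]"
      by (simp add: vec_eq_iff forall_3 ii)
    then show "w \<in> vec.span {vector [- \<i>, 1, 0], vector [0, 0, 1]}"
      unfolding mem_span_pair by blast
  qed (auto simp: mem_span_pair ii)
  then show "vec.span {vector [- \<i>, 1, 0], vector [0, 0, 1]}
      = {w. bform B (vector [- \<i> * of_real h, of_real h, - 1]) w = 0}"
    using h' unfolding h'_def[symmetric] b2 by auto
  have "w \<in> vec.span {vector [0, 0, 1], vector [\<i>, 1, 0]} \<longleftrightarrow> w $ 2 + \<i> * w $ 1 = 0" for w :: "complex ^ 3"
  proof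
    assume "w $ 2 + \<i> * w $ 1 = 0"
    then have "w $ 2 = - \<i> * w $ 1" by (simp add: eq_neg_iff_add_eq_0)
    then have "w = w $ 3 *s vector [0, 0, 1] + w $ 2 *s vector [\<i>, 1, 0]"
      by (simp add: vec_eq_iff forall_3 ii)
    then show "w \<in> vec.span {vector [0, 0, 1], vector [\<i>, 1, 0]}"
      unfolding mem_span_pair by blast
  qed (auto simp: mem_span_pair ii)
  then show "vec.span {vector [0, 0, 1], vector [\<i>, 1, 0]}
      = {w. bform B (vector [\<i> * of_real h, of_real h, - 1]) w = 0}"
    using h' unfolding h'_def[symmetric] b3 by auto
qed

section \<open>The equivalence for a circle and a parabola\<close>

theorem theorem3p1:
  fixes D P :: "(real ^ 2) set" and F :: "real ^ 2"
  assumes "is_circle D"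
    and "is_parabola_with_focus P F"
  shows "poncelet_pair 3 (complexification D) (complexification P) \<longleftrightarrow> F \<in> D"
proof -
  obtain c r where r: "r > 0" and D: "D = sphere c r"
    using assms(1) unfolding is_circle_def by blast
  obtain l where l: "affine l" "aff_dim l = 1" "F \<notin> l" and P: "P = {x. dist x F = infdist x l}"
    using assms(2) unfolding is_parabola_with_focus_def by blast
  obtain a d where a: "norm a = 1" and l_eq: "l = {x. a \<bullet> x = d}"
    using hyperplane_of_line[OF l(1,2)] .
  define h where "h = a \<bullet> F - d"
  have h: "h \<noteq> 0" using l(3) by (simp add: h_def l_eq)
  \<comment> \<open>The frame has its origin at \<open>F\<close>, and (u, v) are the coordinates of
    the centre of the circle in it.\<close>
  define u where "u = a $ 1 * (c $ 2 - F $ 2) - a $ 2 * (c $ 1 - F $ 1)"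
  define v where "v = a \<bullet> (c - F)"
  define S where "S = coframe a F"
  define T where "T = frame a F"
  note TS = frame_coframe(1)[OF a, of F, folded S_def T_def]
    and ST = frame_coframe(2)[OF a, of F, folded S_def T_def]
  define Q where "Q = circle_matrix u v r"
  define R where "R = parabola_matrix h"
  let ?A = "transpose S ** Q ** S" and ?B = "transpose S ** R ** S"
  have detA: "determines_conic (homogeneous ` D) ?A"
    using determines_conic_sphere[OF a r u_def v_def] by (simp add: D Q_def S_def)
  have detB: "determines_conic (homogeneous ` P) ?B"
    using determines_conic_focus_directrix[OF a h_def h] by (simp add: P l_eq R_def S_def)
  note CD = complexification_eq_conic_locus[OF detA] and CP = complexification_eq_conic_locus[OF detB]
  have "u\<^sup>2 + v\<^sup>2 = ((a $ 1)\<^sup>2 + (a $ 2)\<^sup>2) * (dist c F)\<^sup>2"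
    unfolding u_def v_def dist_real2_squared
    by (simp add: inner_real2 power2_eq_square algebra_simps)
  then have F_iff: "F \<in> D \<longleftrightarrow> u\<^sup>2 + v\<^sup>2 = r\<^sup>2"
    using r by (simp add: D unit_real2[OF a])
  let ?S = "complex_matrix S" and ?T = "complex_matrix T"
  have ST': "?S ** ?T = mat 1" and TS': "?T ** ?S = mat 1"
    using ST TS by (metis complex_matrix_mul complex_matrix_mat_1)+
  show ?thesis
  proof
    assume "poncelet_pair 3 (complexification D) (complexification P)"
    then obtain V where poly: "is_polygon 3 V"
      and V: "\<And>i. i < 3 \<Longrightarrow> V i \<in> conic_locus (complex_matrix ?A)"
      and sides: "\<And>i. i < 3 \<Longrightarrow> tangent_line (side 3 V i) (conic_locus (complex_matrix ?B))"
      unfolding poncelet_pair_def poncelet_polygon_def CD CP by blast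
    have "\<forall>i. \<exists>x. i < 3 \<longrightarrow> x \<noteq> 0 \<and> V i = vec.span {x} \<and> bform (complex_matrix ?A) x x = 0"
      using V conic_locusE by metis
    then obtain x where x: "\<And>i. i < 3 \<Longrightarrow> x i \<noteq> 0" "\<And>i. i < 3 \<Longrightarrow> V i = vec.span {x i}"
      "\<And>i. i < 3 \<Longrightarrow> bform (complex_matrix ?A) (x i) (x i) = 0"
      by metis
    have li: "lin_indep3 (x 0) (x 1) (x 2)"
      using is_polygon_triangle_iff[of V x] x poly by blast
    have Vx: "V 0 = vec.span {x 0}" "V 1 = vec.span {x 1}" "V 2 = vec.span {x 2}"
      using x(2) by simp_all
    have t: "tangent_line (side 3 V 0) (conic_locus (complex_matrix ?B))"
      "tangent_line (side 3 V 1) (conic_locus (complex_matrix ?B))"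
      "tangent_line (side 3 V 2) (conic_locus (complex_matrix ?B))"
      using sides by simp_all
    let ?R = "complex_matrix R"
    \<comment> \<open>The point of contact of a side is moved to frame coordinates by
      \<open>S\<close>, where the parabola has matrix \<open>R\<close>; it remains nonzero as
      \<open>S\<close> is invertible.\<close>
    have contact: "\<exists>p. p \<noteq> 0 \<and> bform ?R p p = 0 \<and> bform ?R p (?S *v y) = 0 \<and> bform ?R p (?S *v z) = 0"
      if tangent: "tangent_line (join (vec.span {y}) (vec.span {z})) (conic_locus (complex_matrix ?B))" for y z
    proof -
      obtain p where p: "p \<noteq> 0" "bform ?R (?S *v p) (?S *v p) = 0"
        "bform ?R (?S *v p) (?S *v y) = 0" "bform ?R (?S *v p) (?S *v z) = 0"
        using tangent_line_side_contact[OF detB homogeneous_neq_0 tangent]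
        unfolding bform_complex_congruence by blast
      have "?S *v p \<noteq> 0"
        using p(1) TS' by (metis matrix_vector_mul_assoc matrix_vector_mul_lid matrix_vector_mult_0_right)
      with p show ?thesis by blast
    qed
    have vert: "bform (complex_matrix Q) (?S *v x i) (?S *v x i) = 0" if "i < 3" for i
      using x(3)[OF that] by (simp add: bform_complex_congruence)
    have "u\<^sup>2 + v\<^sup>2 = r\<^sup>2"
    proof (rule triangle_circle_parabola[OF lin_indep3_image[OF li TS'] h])
      show "bform (complex_matrix (circle_matrix u v r)) (?S *v x 0) (?S *v x 0) = 0"
        "bform (complex_matrix (circle_matrix u v r)) (?S *v x 1) (?S *v x 1) = 0"
        "bform (complex_matrix (circle_matrix u v r)) (?S *v x 2) (?S *v x 2) = 0"
        using vert unfolding Q_def by simp_all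
      \<comment> \<open>The contacts are required in the order of the opposite vertices 0, 1, 2,
        which corresponds to the sides 1, 2, 0.\<close>
      show "\<exists>p. p \<noteq> 0 \<and> bform ?R p p = 0 \<and> bform ?R p (?S *v x 1) = 0 \<and> bform ?R p (?S *v x 2) = 0"
        using contact t(2) unfolding triangle_side_simps Vx by blast
      show "\<exists>p. p \<noteq> 0 \<and> bform ?R p p = 0 \<and> bform ?R p (?S *v x 0) = 0 \<and> bform ?R p (?S *v x 2) = 0"
        using contact t(3) unfolding triangle_side_simps Vx by blast
      show "\<exists>p. p \<noteq> 0 \<and> bform ?R p p = 0 \<and> bform ?R p (?S *v x 0) = 0 \<and> bform ?R p (?S *v x 1) = 0"
        using contact t(1) unfolding triangle_side_simps Vx by blast
    qed (simp add: R_def)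
    then show "F \<in> D" by (simp add: F_iff)
  next
    assume "F \<in> D"
    then have uv: "u\<^sup>2 + v\<^sup>2 = r\<^sup>2" by (simp add: F_iff)
    have detS: "det S \<noteq> 0"
      using ST by (metis det_I det_mul mult_zero_left zero_neq_one)
    have smooth: "is_smooth_conic_matrix (complex_matrix ?A)" "is_smooth_conic_matrix (complex_matrix ?B)"
    proof -
      \<comment> \<open>The determinants of \<open>Q\<close> and \<open>R\<close> are -r^2 and
        -h^2.\<close>
      have "det Q \<noteq> 0"
        using r by (simp add: Q_def circle_matrix_def det_3 power2_eq_square)
      moreover have "det R \<noteq> 0"
        using h by (simp add: R_def parabola_matrix_def det_3)
      ultimately show "is_smooth_conic_matrix (complex_matrix ?A)"
        "is_smooth_conic_matrix (complex_matrix ?B)"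
        using detA detB detS
        by (simp_all add: is_smooth_conic_matrix_def det_complex_matrix det_congruence
            determines_conic_def flip: complex_matrix_transpose)
    qed
    let ?I = "vector [\<i>, 1, 0] :: complex ^ 3" and ?J = "vector [- \<i>, 1, 0] :: complex ^ 3"
      and ?O = "vector [0, 0, 1] :: complex ^ 3"
    \<comment> \<open>The isotropic triangle, taken from frame coordinates to the original plane;
      its third vertex is the focus.\<close>
    define x where "x i = ?T *v ([?I, ?J, ?O] ! i)" for i
    define V where "V i = vec.span {x i}" for i
    have x: "x 0 = ?T *v ?I" "x 1 = ?T *v ?J" "x 2 = ?T *v ?O"
      by (simp_all add: x_def)
    have cases3: "i = 0 \<or> i = 1 \<or> i = 2" if "i < 3" for i :: nat
      using that by linarith
    have li: "lin_indep3 (x 0) (x 1) (x 2)"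
      unfolding x by (rule lin_indep3_image[OF isotropic_triangle_lin_indep3 ST'])
    have nz: "x i \<noteq> 0" if "i < 3" for i
    proof
      assume "x i = 0"
      \<comment> \<open>A combination whose only nonzero coefficient stands at the vector
        \<open>x i\<close>, supposed to vanish, contradicts independence.\<close>
      then have "(if i = 0 then 1 else 0) *s x 0 + (if i = 1 then 1 else 0) *s x 1
        + (if i = 2 then 1 else 0) *s x 2 = 0"
        using cases3[OF that] by auto
      then have "(if i = 0 then 1 else 0 :: complex) = 0 \<and> (if i = 1 then 1 else 0 :: complex) = 0
        \<and> (if i = 2 then 1 else 0 :: complex) = 0"
        using li unfolding lin_indep3_def by blast
      then show False using cases3[OF that] by auto
    qed
    have "is_polygon 3 V"
      using is_polygon_triangle_iff[of V x] nz li V_def by blast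
    moreover have "V i \<in> conic_locus (complex_matrix ?A)" if "i < 3" for i
    proof -
      \<comment> \<open>The circular points satisfy the equation of every circle. At the focus the
        form takes the value of the power of the origin, which is 0 by \<open>uv\<close>.\<close>
      have "bform (complex_matrix Q) ([?I, ?J, ?O] ! i) ([?I, ?J, ?O] ! i) = 0"
        using cases3[OF that] by (auto simp: Q_def circle_matrix_def bform_def sum_3 uv)
      then have "bform (complex_matrix ?A) (x i) (x i) = 0"
        by (simp add: x_def bform_complex_congruence matrix_vector_mul_assoc ST')
      then show ?thesis
        unfolding V_def using span_singleton_in_conic_locus[OF nz[OF that]] by blast
    qed
    moreover have "tangent_line (side 3 V i) (conic_locus (complex_matrix ?B))" if "i < 3" for i
    proof -
      note tangent = tangent_side_frame[OF TS ST smooth(2), unfolded R_def]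
      note lines = isotropic_triangle_sides[OF h]
      have "tangent_line (join (V 0) (V 1)) (conic_locus (complex_matrix ?B))"
        unfolding V_def x R_def
        by (rule tangent[OF lines(1)])
          (simp_all add: vec_eq_iff forall_3 bform_def sum_3 parabola_matrix_def)
      moreover have "tangent_line (join (V 1) (V 2)) (conic_locus (complex_matrix ?B))"
        unfolding V_def x R_def
        by (rule tangent[OF lines(2)])
          (simp_all add: vec_eq_iff forall_3 bform_def sum_3 parabola_matrix_def power2_eq_square algebra_simps)
      moreover have "tangent_line (join (V 2) (V 0)) (conic_locus (complex_matrix ?B))"
        unfolding V_def x R_def
        by (rule tangent[OF lines(3)])
          (simp_all add: vec_eq_iff forall_3 bform_def sum_3 parabola_matrix_def power2_eq_square algebra_simps)
      ultimately show ?thesis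
        using cases3[OF that] triangle_side_simps[of V] by metis
    qed
    ultimately show "poncelet_pair 3 (complexification D) (complexification P)"
      unfolding poncelet_pair_def poncelet_polygon_def smooth_conic_def CD CP
      using smooth by blast
  qed
qed

end
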